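(* Let $H$ be a complex Hilbert space, let $A_\pm:D\subset H\to H$ be closed self-adjoint linear operators with common domain $D=\operatorname{Dom}(A_\pm)$ which are either both bounded from below by $\gamma$ or both bounded from above by $\gamma$, for some $\gamma\in\mathbb{R}$, and let $B:H\to H$ be a bounded linear operator with adjoint $B^*$. Then there exists $\rho=\rho(\gamma,\|B\|_{H\to H})>0$ such that for all $\lambda=\lambda_r+\mathrm{i}\lambda_i\in\mathbb{C}$ ($\lambda_r,\lambda_i\in\mathbb{R}$) with $|\lambda_i|\ge\rho$ and $\lambda_r\ne0$, and for every $(\psi_1,\psi_2)\in H\times H$, the problem $$\left[\begin{pmatrix} -\mathrm{i} & 0 \\ 0 & \mathrm{i} \end{pmatrix} \begin{pmatrix} A_+ & B \\ {B^*} & A_- \end{pmatrix} -\lambda \begin{pmatrix} I & 0 \\ 0 & I \end{pmatrix}\right] \begin{pmatrix} \phi_1 \\ \phi_2 \end{pmatrix} = \begin{pmatrix} \psi_1 \\ \psi_2 \end{pmatrix}$$ has a unique solution $(\phi_1,\phi_2)\in D\times D$, and $$\|\phi_1\|+\|\phi_2\|\le C|\lambda_r|^{-1}(\|\psi_1\|+\|\psi_2\|)$$ with a constant $C>0$ independent of $\lambda$ and of $(\psi_1,\psi_2)$.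
   Context: A self-adjoint operator $A$ is bounded from below (above) by $\gamma$ if $\langle A\phi,\phi\rangle\ge\gamma\|\phi\|^2$ (respectively $\le\gamma\|\phi\|^2$) for all $\phi\in\operatorname{Dom}(A)$. $I$ is the identity on $H$. *)

theory Defs
  imports "HOL-Analysis.Analysis"
begin

text \<open>
  Complex Hilbert spaces. The inner product is linear in its first argument. Topology, norm and
  completeness are those of the underlying real normed space; the last axiom ties the norm to
  the inner product and thereby gives positive definiteness.
\<close>

class complex_inner = real_normed_vector +
  fixes scaleC :: "complex \<Rightarrow> 'a \<Rightarrow> 'a"  (infixr "*\<^sub>C" 75)
    and cinner :: "'a \<Rightarrow> 'a \<Rightarrow> complex"
  assumes scaleC_of_real: "complex_of_real r *\<^sub>C x = r *\<^sub>R x"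
    and scaleC_add_right: "c *\<^sub>C (x + y) = c *\<^sub>C x + c *\<^sub>C y"
    and scaleC_add_left: "(c + d) *\<^sub>C x = c *\<^sub>C x + d *\<^sub>C x"
    and scaleC_scaleC: "c *\<^sub>C d *\<^sub>C x = (c * d) *\<^sub>C x"
    and cinner_commute: "cinner x y = cnj (cinner y x)"
    and cinner_add_left: "cinner (x + y) z = cinner x z + cinner y z"
    and cinner_scaleC_left: "cinner (c *\<^sub>C x) y = c * cinner x y"
    and cinner_self: "cinner x x = complex_of_real ((norm x)\<^sup>2)"

class complex_hilbert_space = complex_inner + complete_space

instantiation complex :: complex_hilbert_space
begin

definition scaleC_complex :: "complex \<Rightarrow> complex \<Rightarrow> complex"
  where "scaleC_complex c x = c * x"

definition cinner_complex :: "complex \<Rightarrow> complex \<Rightarrow> complex"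
  where "cinner_complex x y = x * cnj y"

instance
  by standard
    (simp_all add: scaleC_complex_def cinner_complex_def algebra_simps scaleR_conv_of_real
      complex_norm_square flip: of_real_power)

end

text \<open>
  A possibly unbounded operator is a pair of a domain \<open>D\<close> and a total function whose values
  outside \<open>D\<close> are irrelevant. An everywhere defined operator has domain \<open>UNIV\<close>.
\<close>

definition csubspace :: "'a::complex_inner set \<Rightarrow> bool"
  where "csubspace D \<longleftrightarrow>
    0 \<in> D \<and> (\<forall>x\<in>D. \<forall>y\<in>D. x + y \<in> D) \<and> (\<forall>c. \<forall>x\<in>D. c *\<^sub>C x \<in> D)"

definition linear_operator :: "'a::complex_inner set \<Rightarrow> ('a \<Rightarrow> 'a) \<Rightarrow> bool"
  where "linear_operator D A \<longleftrightarrow> csubspace D \<and>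
    (\<forall>x\<in>D. \<forall>y\<in>D. A (x + y) = A x + A y) \<and> (\<forall>c. \<forall>x\<in>D. A (c *\<^sub>C x) = c *\<^sub>C A x)"

definition closed_operator :: "'a::complex_inner set \<Rightarrow> ('a \<Rightarrow> 'a) \<Rightarrow> bool"
  where "closed_operator D A \<longleftrightarrow> closed ((\<lambda>x. (x, A x)) ` D)"

definition cadjoint_domain :: "'a::complex_inner set \<Rightarrow> ('a \<Rightarrow> 'a) \<Rightarrow> 'a set"
  where "cadjoint_domain D A = {y. \<exists>z. \<forall>x\<in>D. cinner (A x) y = cinner x z}"

text \<open>
  The value is determined for \<open>y \<in> cadjoint_domain D A\<close> when \<open>D\<close> is dense.
\<close>

definition cadjoint :: "'a::complex_inner set \<Rightarrow> ('a \<Rightarrow> 'a) \<Rightarrow> 'a \<Rightarrow> 'a"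
  where "cadjoint D A y = (THE z. \<forall>x\<in>D. cinner (A x) y = cinner x z)"

definition self_adjoint :: "'a::complex_inner set \<Rightarrow> ('a \<Rightarrow> 'a) \<Rightarrow> bool"
  where "self_adjoint D A \<longleftrightarrow> linear_operator D A \<and> closure D = UNIV \<and>
    cadjoint_domain D A = D \<and> (\<forall>x\<in>D. cadjoint D A x = A x)"

text \<open>
  For self-adjoint \<open>A\<close> and \<open>x \<in> D\<close> the number \<open>cinner (A x) x\<close> is real, so \<open>Re\<close> loses nothing.
\<close>

definition bounded_from_below :: "'a::complex_inner set \<Rightarrow> ('a \<Rightarrow> 'a) \<Rightarrow> real \<Rightarrow> bool"
  where "bounded_from_below D A \<gamma> \<longleftrightarrow> (\<forall>x\<in>D. Re (cinner (A x) x) \<ge> \<gamma> * (norm x)\<^sup>2)"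

definition bounded_from_above :: "'a::complex_inner set \<Rightarrow> ('a \<Rightarrow> 'a) \<Rightarrow> real \<Rightarrow> bool"
  where "bounded_from_above D A \<gamma> \<longleftrightarrow> (\<forall>x\<in>D. Re (cinner (A x) x) \<le> \<gamma> * (norm x)\<^sup>2)"

definition bounded_clinear :: "('a::complex_inner \<Rightarrow> 'a) \<Rightarrow> bool"
  where "bounded_clinear B \<longleftrightarrow> bounded_linear B \<and> (\<forall>c x. B (c *\<^sub>C x) = c *\<^sub>C B x)"

definition block_op ::
    "('a \<Rightarrow> 'a) \<Rightarrow> ('a \<Rightarrow> 'a) \<Rightarrow> ('a \<Rightarrow> 'a) \<Rightarrow> ('a \<Rightarrow> 'a) \<Rightarrow> 'a \<times> 'a \<Rightarrow> 'a::ab_group_add \<times> 'a"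
  where "block_op P Q R S = (\<lambda>(x, y). (P x + Q y, R x + S y))"

text \<open>
  The operator \<open>diag (-i, i) (A\<^sub>+, B; B\<^sup>*, A\<^sub>-) - l diag (I, I)\<close> on pairs.
\<close>

definition shifted_op ::
    "('a::complex_inner \<Rightarrow> 'a) \<Rightarrow> ('a \<Rightarrow> 'a) \<Rightarrow> ('a \<Rightarrow> 'a) \<Rightarrow> complex \<Rightarrow> 'a \<times> 'a \<Rightarrow> 'a \<times> 'a"
  where "shifted_op Ap Am B l \<phi> =
    block_op (scaleC (- \<i>)) (\<lambda>_. 0) (\<lambda>_. 0) (scaleC \<i>)
      (block_op Ap B (cadjoint UNIV B) Am \<phi>)
    - block_op (scaleC l) (\<lambda>_. 0) (\<lambda>_. 0) (scaleC l) \<phi>"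

end

theory Submission
  imports Defs
begin

text \<open>
  Put \<open>\<mu> = \<i> * l\<close>. Multiplying the two rows by \<open>\<i>\<close> and \<open>- \<i>\<close> turns the problem into
  \<open>(A\<^sub>+ - \<mu>) x + B y = f\<close>, \<open>B\<^sup>* x + (A\<^sub>- + \<mu>) y = g\<close> with data of the same norms as before; here
  \<open>Re \<mu> = - Im l\<close> and \<open>Im \<mu> = Re l\<close>. The shifts \<open>- \<mu>\<close> and \<open>\<mu>\<close> have opposite real parts, so when
  \<open>\<bar>Re \<mu>\<bar>\<close> is large and both operators are semibounded on the same side, at least one of
  \<open>A\<^sub>+ - Re \<mu>\<close>, \<open>A\<^sub>- + Re \<mu>\<close> is pushed away from the spectrum: its quadratic form is at least
  \<open>m = 2 * onorm B + 1\<close> in absolute value. No lower bound is available for the form of the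
  other one.

  Two pairings suffice for the estimate (\<open>coupled_estimate\<close>). Say \<open>x\<close> is the component with the
  coercive form. Testing the first row with \<open>x\<close> gives
  \<open>norm x \<le> norm f / \<bar>Im \<mu>\<bar> + norm y / 2\<close>. Testing row one with \<open>x\<close>, row two with \<open>y\<close> and taking
  the imaginary part of the sum eliminates both operators and the coupling, and leaves
  \<open>Im \<mu> * ((norm y)\<^sup>2 - (norm x)\<^sup>2)\<close>; after division by \<open>norm x + norm y\<close> this bounds
  \<open>norm y - norm x\<close>. The factor \<open>1 / 2\<close> in the first bound lets the two be combined.

  Existence follows from the same estimate. The pencil with parameter \<open>\<mu>\<close> is the Hilbert space
  adjoint of the one with parameter \<open>cnj \<mu>\<close> (\<open>block_pencil_graph\<close>), and \<open>cnj \<mu>\<close> satisfies the same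
  assumptions as \<open>\<mu>\<close>. So the pencil is bounded from below and closed, which makes its range closed,
  and the orthogonal complement of the range is the kernel of the adjoint pencil, which is trivial
  (\<open>surjective_of_bounded_below\<close>). The projection theorem and the existence of adjoints of bounded
  operators are derived from the axioms of a complex Hilbert space.
\<close>

section \<open>Complex inner product spaces\<close>

lemma cinner_add_right: "cinner x (y + z) = cinner x y + cinner x z"
  by (metis cinner_add_left cinner_commute complex_cnj_add)

lemma cinner_scaleC_right: "cinner x (c *\<^sub>C y) = cnj c * cinner x y"
  by (metis cinner_scaleC_left cinner_commute complex_cnj_mult)

lemma cinner_scaleR_left: "cinner (r *\<^sub>R x) y = r *\<^sub>R cinner x y"
  by (metis cinner_scaleC_left scaleC_of_real scaleR_conv_of_real)

lemma cinner_scaleR_right: "cinner x (r *\<^sub>R y) = r *\<^sub>R cinner x y"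
  by (metis cinner_scaleR_left cinner_commute complex_cnj_scaleR)

lemma scaleC_minus_one: "(-1) *\<^sub>C x = - x"
  using scaleC_of_real[of "-1" x] by simp

lemma scaleC_one: "1 *\<^sub>C x = x"
  using scaleC_of_real[of 1 x] by simp

lemma scaleC_zero_left: "0 *\<^sub>C x = 0"
  using scaleC_of_real[of 0 x] by simp

lemma scaleC_zero_right: "c *\<^sub>C 0 = 0"
  using scaleC_add_right[of c 0 0] by simp

lemma scaleC_minus_right: "c *\<^sub>C (- x) = - (c *\<^sub>C x)"
  by (metis add.inverse_unique add.right_inverse scaleC_add_right scaleC_zero_right)

lemma scaleC_minus_left: "(- c) *\<^sub>C x = - (c *\<^sub>C x)"
  by (metis mult_minus1 scaleC_minus_one scaleC_scaleC)

lemma scaleC_diff_right: "c *\<^sub>C (x - y) = c *\<^sub>C x - c *\<^sub>C y"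
  by (metis diff_conv_add_uminus scaleC_add_right scaleC_minus_right)

lemma cinner_minus_left: "cinner (- x) y = - cinner x y"
  using cinner_scaleC_left[of "-1" x y] by (simp add: scaleC_minus_one)

lemma cinner_minus_right: "cinner x (- y) = - cinner x y"
  using cinner_scaleC_right[of x "-1" y] by (simp add: scaleC_minus_one)

lemma cinner_diff_left: "cinner (x - y) z = cinner x z - cinner y z"
  using cinner_add_left[of x "- y" z] by (simp add: cinner_minus_left)

lemma cinner_diff_right: "cinner x (y - z) = cinner x y - cinner x z"
  using cinner_add_right[of x y "- z"] by (simp add: cinner_minus_right)

lemma cinner_zero_left: "cinner 0 x = 0"
  using cinner_add_left[of 0 0 x] by simp

lemma cinner_zero_right: "cinner x 0 = 0"
  using cinner_add_right[of x 0 0] by simp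

lemma cinner_self_eq_0: "cinner x x = 0 \<longleftrightarrow> x = 0"
  by (simp add: cinner_self)

lemma norm_scaleC: "norm (c *\<^sub>C x) = cmod c * norm x"
proof -
  have "complex_of_real ((norm (c *\<^sub>C x))\<^sup>2) = c * cnj c * complex_of_real ((norm x)\<^sup>2)"
    by (simp only: cinner_self[symmetric] cinner_scaleC_left cinner_scaleC_right ac_simps)
  also have "\<dots> = complex_of_real ((cmod c * norm x)\<^sup>2)"
    by (simp add: complex_norm_square[symmetric] power_mult_distrib)
  finally have "(norm (c *\<^sub>C x))\<^sup>2 = (cmod c * norm x)\<^sup>2"
    by (simp only: of_real_eq_iff)
  then show ?thesis
    by (simp add: power2_eq_iff_nonneg)
qed

lemma power2_norm_add:
  "(norm (x + y))\<^sup>2 = (norm x)\<^sup>2 + 2 * Re (cinner x y) + (norm (y :: 'a::complex_inner))\<^sup>2"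
proof -
  have "(norm (x + y))\<^sup>2 = Re (cinner (x + y) (x + y))"
    by (simp only: cinner_self Re_complex_of_real)
  also have "\<dots> = Re (cinner x x) + Re (cinner x y) + Re (cinner y x) + Re (cinner y y)"
    by (simp add: cinner_add_left cinner_add_right)
  also have "Re (cinner y x) = Re (cinner x y)"
    by (subst cinner_commute) simp
  finally show ?thesis
    by (simp add: cinner_self del: of_real_power)
qed

lemma power2_norm_diff:
  "(norm (x - y))\<^sup>2 = (norm x)\<^sup>2 - 2 * Re (cinner x y) + (norm (y :: 'a::complex_inner))\<^sup>2"
  using power2_norm_add[of x "- y"] by (simp add: cinner_minus_right)

lemma parallelogram_law:
  "(norm (x + y))\<^sup>2 + (norm (x - y))\<^sup>2 = 2 * (norm x)\<^sup>2 + 2 * (norm (y :: 'a::complex_inner))\<^sup>2"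
  by (simp add: power2_norm_add power2_norm_diff)

text \<open>
  Pythagoras for the component of \<open>x\<close> orthogonal to \<open>y\<close>. Nonnegativity of the left-hand side is
  the Cauchy-Schwarz inequality; comparison with a nearest point yields orthogonality.
\<close>

lemma power2_norm_diff_projection:
  assumes "y \<noteq> 0"
  shows "(norm (x - (cinner x y / complex_of_real ((norm y)\<^sup>2)) *\<^sub>C y))\<^sup>2
    = (norm x)\<^sup>2 - (cmod (cinner x y))\<^sup>2 / (norm y)\<^sup>2"
proof -
  define c where "c = cinner x y"
  define n where "n = (norm y)\<^sup>2"
  have n: "n > 0"
    using assms by (simp add: n_def)
  have "cinner x ((c / complex_of_real n) *\<^sub>C y) = cnj (c / complex_of_real n) * c"
    by (simp add: cinner_scaleC_right c_def)
  also have "\<dots> = complex_of_real ((cmod c)\<^sup>2 / n)"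
    using complex_norm_square[of c] by (simp add: mult.commute)
  finally have re: "Re (cinner x ((c / complex_of_real n) *\<^sub>C y)) = (cmod c)\<^sup>2 / n"
    by (simp only: Re_complex_of_real)
  have "(norm ((c / complex_of_real n) *\<^sub>C y))\<^sup>2 = (cmod c)\<^sup>2 / n"
    using n by (simp add: norm_scaleC norm_divide power_mult_distrib power_divide
        flip: n_def) (simp add: power2_eq_square)
  then show ?thesis
    unfolding power2_norm_diff c_def[symmetric] n_def[symmetric] re by simp
qed

lemma norm_cinner_le: "cmod (cinner x y) \<le> norm x * norm y"
proof (cases "y = 0")
  case False
  have "0 \<le> (norm x)\<^sup>2 - (cmod (cinner x y))\<^sup>2 / (norm y)\<^sup>2"
    using power2_norm_diff_projection[OF False, of x] by (metis zero_le_power2)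
  then have "(cmod (cinner x y))\<^sup>2 \<le> (norm x * norm y)\<^sup>2"
    using False by (simp add: field_simps power_mult_distrib)
  then show ?thesis
    by (rule power2_le_imp_le) simp
qed (simp add: cinner_zero_right)

lemma bounded_bilinear_cinner: "bounded_bilinear cinner"
  by (rule bounded_bilinear.intro)
    (auto simp: cinner_add_left cinner_add_right cinner_scaleR_left cinner_scaleR_right
      intro!: exI[of _ 1] norm_cinner_le)

lemmas tendsto_cinner = bounded_bilinear.tendsto[OF bounded_bilinear_cinner]

lemma closed_cinner_eq_0: "closed {x. cinner x z = 0}"
  by (intro closed_Collect_eq continuous_intros continuous_on_const)
    (auto intro!: continuous_at_imp_continuous_on
      bounded_linear.isCont[OF bounded_bilinear.bounded_linear_left[OF bounded_bilinear_cinner]])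

text \<open>
  The norm of a product type is already the Euclidean one, so the sum of the two inner products
  turns the block problem into a problem for a single operator on a Hilbert space.
\<close>

instantiation prod :: (complex_inner, complex_inner) complex_inner
begin

definition scaleC_prod :: "complex \<Rightarrow> 'a \<times> 'b \<Rightarrow> 'a \<times> 'b"
  where "scaleC_prod c p = (c *\<^sub>C fst p, c *\<^sub>C snd p)"

definition cinner_prod :: "'a \<times> 'b \<Rightarrow> 'a \<times> 'b \<Rightarrow> complex"
  where "cinner_prod p q = cinner (fst p) (fst q) + cinner (snd p) (snd q)"

instance
proof
  fix x y :: "'a \<times> 'b"
  show "cinner x y = cnj (cinner y x)"
    using cinner_commute[of "fst x" "fst y"] cinner_commute[of "snd x" "snd y"]
    by (simp add: cinner_prod_def)
qed (simp_all add: scaleC_prod_def cinner_prod_def scaleC_of_real scaleC_add_right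
    scaleC_add_left scaleC_scaleC cinner_add_left cinner_scaleC_left cinner_self
    prod_eq_iff norm_prod_def algebra_simps)

end

instance prod :: (complex_hilbert_space, complex_hilbert_space) complex_hilbert_space ..

section \<open>Orthogonal complements and adjoints\<close>

lemma csubspace_diff:
  assumes "csubspace V" "x \<in> V" "y \<in> V"
  shows "x - y \<in> V"
  using assms scaleC_minus_one[of y] unfolding csubspace_def
  by (metis diff_conv_add_uminus)

lemma csubspace_scaleR:
  assumes "csubspace V" "x \<in> V"
  shows "r *\<^sub>R x \<in> V"
  using assms unfolding csubspace_def by (metis scaleC_of_real)

text \<open>
  A minimizing sequence is a Cauchy sequence: by the parallelogram law if two of
  its late members were far apart, their midpoint, which lies in the subspace, would be closer to
  \<open>x\<close> than the infimum.
\<close>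

lemma closed_csubspace_nearest_point:
  fixes V :: "'a::complex_hilbert_space set"
  assumes V: "csubspace V" and "closed V"
  obtains v where "v \<in> V" "\<And>w. w \<in> V \<Longrightarrow> norm (x - v) \<le> norm (x - w)"
proof -
  define d where "d = infdist x V"
  have ne: "V \<noteq> {}"
    using V by (auto simp: csubspace_def)
  have d0: "d \<ge> 0"
    by (simp add: d_def infdist_nonneg)
  have d_le: "d \<le> norm (x - w)" if "w \<in> V" for w
    using infdist_le[OF that, of x] by (simp add: d_def dist_norm)
  have "\<exists>w\<in>V. norm (x - w) < d + inverse (real (Suc n))" for n
  proof (rule ccontr)
    assume "\<not> ?thesis"
    then have "d + inverse (real (Suc n)) \<le> (INF w\<in>V. dist x w)"
      using ne by (intro cINF_greatest) (auto simp: dist_norm not_less)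
    then show False
      using ne by (simp add: d_def infdist_def)
  qed
  then obtain v where vV: "\<And>n. v n \<in> V"
    and v_less: "\<And>n. norm (x - v n) < d + inverse (real (Suc n))"
    by metis
  define c where "c n = 4 * ((d + inverse (real (Suc n)))\<^sup>2 - d\<^sup>2)" for n
  have inv0: "(\<lambda>n. inverse (real (Suc n))) \<longlonglongrightarrow> 0"
    by (rule LIMSEQ_inverse_real_of_nat)
  have c0: "c \<longlonglongrightarrow> 4 * ((d + 0)\<^sup>2 - d\<^sup>2)"
    unfolding c_def by (intro tendsto_intros inv0)
  have near: "(norm (v m - v n))\<^sup>2 \<le> c N" if "N \<le> m" "N \<le> n" for m n N
  proof -
    have le: "(norm (x - v k))\<^sup>2 \<le> (d + inverse (real (Suc N)))\<^sup>2" if "N \<le> k" for k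
    proof -
      have "inverse (real (Suc k)) \<le> inverse (real (Suc N))"
        using that by (intro le_imp_inverse_le) auto
      then show ?thesis
        using v_less[of k] by (intro power_mono norm_ge_zero) linarith
    qed
    \<comment> \<open>The midpoint lies in the subspace, so its distance from \<open>x\<close> is at least \<open>d\<close>.\<close>
    have "(1/2) *\<^sub>R (v m + v n) \<in> V"
      using vV V by (intro csubspace_scaleR) (auto simp: csubspace_def)
    then have "d\<^sup>2 \<le> (norm (x - (1/2) *\<^sub>R (v m + v n)))\<^sup>2"
      using d_le d0 by (intro power_mono) auto
    also have "x - (1/2) *\<^sub>R (v m + v n) = (1/2) *\<^sub>R ((x - v m) + (x - v n))"
      by (simp add: algebra_simps flip: scaleR_2)
    finally have "4 * d\<^sup>2 \<le> (norm ((x - v m) + (x - v n)))\<^sup>2"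
      by (simp only: norm_scaleR power_mult_distrib) (simp add: power2_eq_square)
    moreover have "(norm ((x - v m) + (x - v n)))\<^sup>2 + (norm (v m - v n))\<^sup>2
        = 2 * (norm (x - v m))\<^sup>2 + 2 * (norm (x - v n))\<^sup>2"
      using parallelogram_law[of "x - v m" "x - v n"] by (simp add: norm_minus_commute)
    ultimately show ?thesis
      using le[OF that(1)] le[OF that(2)] unfolding c_def right_diff_distrib
      by (simp only: mult_2)
  qed
  have "Cauchy v"
  proof (rule CauchyI)
    fix e :: real
    assume e: "0 < e"
    have "\<forall>\<^sub>F n in sequentially. c n < e\<^sup>2"
      using order_tendstoD(2)[OF c0, of "e\<^sup>2"] e by simp
    then obtain N where "c N < e\<^sup>2"
      by (auto simp: eventually_sequentially)
    then have "norm (v m - v n) < e" if "N \<le> m" "N \<le> n" for m n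
      using near[OF that] e by (intro power2_less_imp_less[of _ e]) auto
    then show "\<exists>N. \<forall>m\<ge>N. \<forall>n\<ge>N. norm (v m - v n) < e"
      by blast
  qed
  then obtain l where l: "v \<longlonglongrightarrow> l"
    using Cauchy_convergent convergent_def by blast
  have "l \<in> V"
    using \<open>closed V\<close> vV l closed_sequentially by blast
  moreover have "norm (x - l) \<le> d + 0"
  proof (rule LIMSEQ_le)
    show "(\<lambda>n. norm (x - v n)) \<longlonglongrightarrow> norm (x - l)"
      by (intro tendsto_intros l)
    show "(\<lambda>n. d + inverse (real (Suc n))) \<longlonglongrightarrow> d + 0"
      by (intro tendsto_intros inv0)
    show "\<exists>N. \<forall>n\<ge>N. norm (x - v n) \<le> d + inverse (real (Suc n))"
      using v_less by (meson less_imp_le)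
  qed
  ultimately show thesis
    using that[of l] d_le by fastforce
qed

text \<open>
  The difference between a point outside the subspace and its nearest point does not get shorter
  when its component along some \<open>w\<close> in the subspace is removed, so that component vanishes.
\<close>

lemma closed_proper_csubspace_orthogonal:
  fixes V :: "'a::complex_hilbert_space set"
  assumes V: "csubspace V" "closed V" "V \<noteq> UNIV"
  shows "\<exists>u. u \<noteq> 0 \<and> (\<forall>w\<in>V. cinner w u = 0)"
proof -
  obtain x where x: "x \<notin> V"
    using V(3) by blast
  obtain v where v: "v \<in> V" and min: "\<And>w. w \<in> V \<Longrightarrow> norm (x - v) \<le> norm (x - w)"
    using closed_csubspace_nearest_point[OF V(1,2)] by blast
  have "cinner w (x - v) = 0" if w: "w \<in> V" for w
  proof (cases "w = 0")
    case False
    define c where "c = cinner (x - v) w / complex_of_real ((norm w)\<^sup>2)"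
    have "v + c *\<^sub>C w \<in> V"
      using V(1) v w by (simp add: csubspace_def)
    then have "(norm (x - v))\<^sup>2 \<le> (norm (x - v - c *\<^sub>C w))\<^sup>2"
      using min by (metis diff_diff_eq norm_ge_zero power_mono)
    then have "(cmod (cinner (x - v) w))\<^sup>2 / (norm w)\<^sup>2 \<le> 0"
      unfolding c_def power2_norm_diff_projection[OF False] by simp
    then have "cinner (x - v) w = 0"
      using False by (simp add: divide_le_0_iff)
    then show ?thesis
      by (metis cinner_commute complex_cnj_zero)
  qed (simp add: cinner_zero_left)
  then show ?thesis
    using x v by (intro exI[of _ "x - v"]) auto
qed

text \<open>
  Riesz representation of the functional \<open>\<lambda>x. cinner (B x) y\<close>: unless it is zero, its kernel has a
  nonzero orthogonal vector \<open>u\<close>, and the functional is a multiple of \<open>\<lambda>x. cinner x u\<close>.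
\<close>

lemma bounded_clinear_adjoint_exists:
  fixes B :: "'a::complex_hilbert_space \<Rightarrow> 'a"
  assumes B: "bounded_clinear B"
  shows "\<exists>z. \<forall>x. cinner (B x) y = cinner x z"
proof -
  have lin: "bounded_linear B" and sc: "\<And>c x. B (c *\<^sub>C x) = c *\<^sub>C B x"
    using B by (auto simp: bounded_clinear_def)
  define N where "N = {x. cinner (B x) y = 0}"
  show ?thesis
  proof (cases "N = UNIV")
    case True
    then have "\<forall>x. cinner (B x) y = cinner x 0"
      by (auto simp: N_def cinner_zero_right)
    then show ?thesis ..
  next
    case False
    have "csubspace N"
      by (auto simp: csubspace_def N_def linear_simps[OF lin] sc cinner_zero_left
          cinner_add_left cinner_scaleC_left)
    moreover have "closed N"
    proof -
      have "N = B -` {x. cinner x y = 0}"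
        by (auto simp: N_def)
      then show ?thesis
        using closed_vimage[OF closed_cinner_eq_0 linear_continuous_on[OF lin, of UNIV]]
        by simp
    qed
    ultimately obtain u where u: "u \<noteq> 0" "\<forall>w\<in>N. cinner w u = 0"
      using closed_proper_csubspace_orthogonal[OF _ _ False] by metis
    define a where "a = cinner (B u) y"
    define n where "n = complex_of_real ((norm u)\<^sup>2)"
    have n: "n \<noteq> 0" "cnj n = n"
      using u(1) by (auto simp: n_def)
    have "cinner (B x) y = cinner x ((cnj a / n) *\<^sub>C u)" for x
    proof -
      \<comment> \<open>Since \<open>a\<close> is the value of the functional at \<open>u\<close>, it vanishes at this combination.\<close>
      have "a *\<^sub>C x - cinner (B x) y *\<^sub>C u \<in> N"
        by (simp add: N_def linear_simps[OF lin] sc cinner_diff_left cinner_scaleC_left a_def)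
      then have "a * cinner x u = cinner (B x) y * n"
        using u(2) by (fastforce simp: cinner_diff_left cinner_scaleC_left cinner_self n_def)
      then show ?thesis
        using n by (simp add: cinner_scaleC_right field_simps)
    qed
    then show ?thesis
      by blast
  qed
qed

lemma dense_cinner_eqD:
  assumes "closure D = UNIV" "\<And>x. x \<in> D \<Longrightarrow> cinner x z = cinner x z'"
  shows "z = z'"
proof -
  have "D \<subseteq> {x. cinner x (z - z') = 0}"
    using assms(2) by (auto simp: cinner_diff_right)
  then have "closure D \<subseteq> {x. cinner x (z - z') = 0}"
    by (rule closure_minimal[OF _ closed_cinner_eq_0])
  then have "cinner (z - z') (z - z') = 0"
    using assms(1) by auto
  then show ?thesis
    by (simp add: cinner_self_eq_0)
qed

lemma cadjoint_eqI:
  assumes "closure D = UNIV" "\<And>x. x \<in> D \<Longrightarrow> cinner (A x) y = cinner x z"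
  shows "cadjoint D A y = z"
  unfolding cadjoint_def
proof (rule the_equality)
  fix z'
  assume "\<forall>x\<in>D. cinner (A x) y = cinner x z'"
  then show "z' = z"
    using assms(2) by (intro dense_cinner_eqD[OF assms(1)]) metis
qed (use assms(2) in blast)

lemma cinner_cadjoint:
  fixes B :: "'a::complex_hilbert_space \<Rightarrow> 'a"
  assumes "bounded_clinear B"
  shows "cinner (B x) y = cinner x (cadjoint UNIV B y)"
proof -
  obtain z where z: "\<forall>x. cinner (B x) y = cinner x z"
    using bounded_clinear_adjoint_exists[OF assms] by blast
  then have "cadjoint UNIV B y = z"
    by (intro cadjoint_eqI) auto
  with z show ?thesis
    by simp
qed

lemma cinner_eqD: "(\<And>x. cinner x y = cinner x z) \<Longrightarrow> y = z"
  by (rule dense_cinner_eqD[of UNIV]) auto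

lemma cadjoint_add:
  fixes B :: "'a::complex_hilbert_space \<Rightarrow> 'a"
  assumes "bounded_clinear B"
  shows "cadjoint UNIV B (x + y) = cadjoint UNIV B x + cadjoint UNIV B y"
  by (rule cinner_eqD) (simp add: cinner_add_right flip: cinner_cadjoint[OF assms])

lemma cadjoint_scaleC:
  fixes B :: "'a::complex_hilbert_space \<Rightarrow> 'a"
  assumes "bounded_clinear B"
  shows "cadjoint UNIV B (c *\<^sub>C x) = c *\<^sub>C cadjoint UNIV B x"
  by (rule cinner_eqD) (simp add: cinner_scaleC_right flip: cinner_cadjoint[OF assms])

lemma norm_cadjoint_le:
  fixes B :: "'a::complex_hilbert_space \<Rightarrow> 'a"
  assumes "bounded_clinear B"
  shows "norm (cadjoint UNIV B y) \<le> onorm B * norm y"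
proof -
  let ?z = "cadjoint UNIV B y"
  have lin: "bounded_linear B"
    using assms by (simp add: bounded_clinear_def)
  have "norm ?z * norm ?z = cmod (cinner (B ?z) y)"
    by (simp add: cinner_cadjoint[OF assms] cinner_self norm_power power2_eq_square norm_mult)
  also have "\<dots> \<le> norm (B ?z) * norm y"
    by (rule norm_cinner_le)
  also have "\<dots> \<le> onorm B * norm ?z * norm y"
    by (intro mult_right_mono onorm[OF lin]) simp
  finally have "norm ?z * norm ?z \<le> norm ?z * (onorm B * norm y)"
    by (simp add: algebra_simps)
  then show ?thesis
    using onorm_pos_le[OF lin] by (cases "?z = 0") auto
qed

text \<open>
  The form in which self-adjointness is used: the weak equation alone forces \<open>y\<close> into the domain.
\<close>

lemma self_adjoint_graph:
  assumes A: "self_adjoint D A"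
  shows "(\<forall>x\<in>D. cinner (A x) y = cinner x z) \<longleftrightarrow> y \<in> D \<and> A y = z"
proof
  have dense: "closure D = UNIV"
    using A by (simp add: self_adjoint_def)
  assume *: "\<forall>x\<in>D. cinner (A x) y = cinner x z"
  then have "y \<in> D"
    using A by (auto simp: self_adjoint_def cadjoint_domain_def)
  moreover have "cadjoint D A y = z"
    using * by (intro cadjoint_eqI[OF dense]) auto
  ultimately show "y \<in> D \<and> A y = z"
    using A by (simp add: self_adjoint_def)
next
  have dense: "closure D = UNIV"
    using A by (simp add: self_adjoint_def)
  assume y: "y \<in> D \<and> A y = z"
  then have "y \<in> cadjoint_domain D A"
    using A by (simp add: self_adjoint_def)
  then obtain z' where z': "\<forall>x\<in>D. cinner (A x) y = cinner x z'"
    by (auto simp: cadjoint_domain_def)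
  then have "cadjoint D A y = z'"
    by (intro cadjoint_eqI[OF dense]) auto
  then show "\<forall>x\<in>D. cinner (A x) y = cinner x z"
    using A y z' by (simp add: self_adjoint_def)
qed

lemma self_adjoint_symmetric:
  assumes "self_adjoint D A" "x \<in> D" "y \<in> D"
  shows "cinner (A x) y = cinner x (A y)"
  using self_adjoint_graph[OF assms(1), of y "A y"] assms(2,3) by blast

lemma self_adjoint_Im_eq_0:
  assumes "self_adjoint D A" "x \<in> D"
  shows "Im (cinner (A x) x) = 0"
proof -
  have "cnj (cinner (A x) x) = cinner (A x) x"
    using self_adjoint_symmetric[OF assms assms(2)] cinner_commute[of x "A x"] by simp
  then show ?thesis
    by (simp add: complex_eq_iff)
qed

text \<open>
  Assumption \<open>adj\<close> says that \<open>A\<close> is the adjoint of \<open>A'\<close>. An adjoint has a closed graph, because the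
  weak equations that define it pass to limits. With the lower bound, preimages of a convergent
  sequence converge, so the range is closed; by \<open>dense\<close> nothing is orthogonal to it.
\<close>

lemma surjective_of_bounded_below:
  fixes A A' :: "'a::complex_hilbert_space \<Rightarrow> 'a"
  assumes A: "linear_operator D A"
    and adj: "\<And>y z. (\<forall>x\<in>D'. cinner (A' x) y = cinner x z) \<longleftrightarrow> y \<in> D \<and> A y = z"
    and lower: "\<And>x. x \<in> D \<Longrightarrow> norm x \<le> c * norm (A x)"
    and dense: "\<And>y. (\<And>x. x \<in> D \<Longrightarrow> cinner (A x) y = 0) \<Longrightarrow> y = 0"
  shows "\<exists>x\<in>D. A x = z"
proof -
  have D: "csubspace D" and add: "\<And>x y. x \<in> D \<Longrightarrow> y \<in> D \<Longrightarrow> A (x + y) = A x + A y"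
    and sc: "\<And>c x. x \<in> D \<Longrightarrow> A (c *\<^sub>C x) = c *\<^sub>C A x"
    using A by (auto simp: linear_operator_def)
  have D': "0 \<in> D" "\<And>x y. x \<in> D \<Longrightarrow> y \<in> D \<Longrightarrow> x + y \<in> D" "\<And>c x. x \<in> D \<Longrightarrow> c *\<^sub>C x \<in> D"
    using D by (auto simp: csubspace_def)
  have diff: "A (x - y) = A x - A y" if "x \<in> D" "y \<in> D" for x y
    using that add[of x "- y"] sc[of y "-1"] D'(3)[of y "-1"] by (simp add: scaleC_minus_one)
  have range_subspace: "csubspace (A ` D)"
    unfolding csubspace_def
  proof (intro conjI ballI allI)
    show "0 \<in> A ` D"
      using sc[OF D'(1), of 0] D'(1) by (metis image_eqI scaleC_zero_left)
    show "p + q \<in> A ` D" if "p \<in> A ` D" "q \<in> A ` D" for p q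
      using that add D'(2) by (metis (no_types, opaque_lifting) imageE image_eqI)
    show "c *\<^sub>C p \<in> A ` D" if "p \<in> A ` D" for c p
      using that sc D'(3) by (metis (no_types, opaque_lifting) imageE image_eqI)
  qed
  have range_closed: "closed (A ` D)"
    unfolding closed_sequential_limits
  proof (intro allI impI, elim conjE)
    fix p l
    assume p: "\<forall>n. p n \<in> A ` D" and l: "p \<longlonglongrightarrow> l"
    define x where "x n = inv_into D A (p n)" for n
    have x: "x n \<in> D" "A (x n) = p n" for n
      using p by (auto simp: x_def inv_into_into f_inv_into_f)
    have "Cauchy x"
    proof (rule CauchyI)
      fix e :: real
      assume e: "0 < e"
      have "0 < e / (\<bar>c\<bar> + 1)"
        using e by simp
      then obtain N where N: "\<forall>m\<ge>N. \<forall>n\<ge>N. norm (p m - p n) < e / (\<bar>c\<bar> + 1)"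
        using LIMSEQ_imp_Cauchy[OF l] by (meson CauchyD)
      have "norm (x m - x n) < e" if "m \<ge> N" "n \<ge> N" for m n
      proof -
        have "norm (x m - x n) \<le> c * norm (p m - p n)"
          using lower[OF csubspace_diff[OF D x(1) x(1)]] by (simp add: diff x)
        also have "\<dots> \<le> (\<bar>c\<bar> + 1) * norm (p m - p n)"
          by (intro mult_right_mono) auto
        also have "\<dots> < e"
          using N that by (simp add: field_simps)
        finally show ?thesis .
      qed
      then show "\<exists>N. \<forall>m\<ge>N. \<forall>n\<ge>N. norm (x m - x n) < e"
        by blast
    qed
    then obtain y where y: "x \<longlonglongrightarrow> y"
      using Cauchy_convergent convergent_def by blast
    have lim: "cinner (A' w) y = cinner w l" if "w \<in> D'" for w
    proof (rule LIMSEQ_unique)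
      show "(\<lambda>n. cinner (A' w) (x n)) \<longlonglongrightarrow> cinner (A' w) y"
        by (intro tendsto_cinner tendsto_const y)
      have "cinner (A' w) (x n) = cinner w (p n)" for n
        using adj[of "x n" "p n"] x that by blast
      then show "(\<lambda>n. cinner (A' w) (x n)) \<longlonglongrightarrow> cinner w l"
        using tendsto_cinner[OF tendsto_const l, of w] by simp
    qed
    then have "y \<in> D \<and> A y = l"
      using adj[of y l] lim by simp
    then show "l \<in> A ` D"
      by auto
  qed
  have "A ` D = UNIV"
  proof (rule ccontr)
    assume "A ` D \<noteq> UNIV"
    then obtain u where "u \<noteq> 0" and u: "\<forall>w\<in>A ` D. cinner w u = 0"
      using closed_proper_csubspace_orthogonal[OF range_subspace range_closed] by metis
    moreover have "u = 0"
      by (rule dense) (simp add: u)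
    ultimately show False
      by simp
  qed
  then have "z \<in> A ` D"
    by simp
  then show ?thesis
    by blast
qed

section \<open>The block pencil\<close>

text \<open>
  The row-rotated form of \<open>shifted_op\<close>, with the spectral parameter \<open>\<mu> = \<i> * l\<close>. Here the operator
  part is symmetric and all deviation from symmetry sits in the diagonal shifts.
\<close>

definition block_pencil ::
    "('a::complex_inner \<Rightarrow> 'a) \<Rightarrow> ('a \<Rightarrow> 'a) \<Rightarrow> ('a \<Rightarrow> 'a) \<Rightarrow> complex \<Rightarrow> 'a \<times> 'a \<Rightarrow> 'a \<times> 'a"
  where "block_pencil Ap Am B \<mu> p =
    (Ap (fst p) + B (snd p) - \<mu> *\<^sub>C fst p, cadjoint UNIV B (fst p) + Am (snd p) + \<mu> *\<^sub>C snd p)"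

lemma shifted_op_eq_iff_block_pencil:
  "shifted_op Ap Am B l p = (\<psi>1, \<psi>2) \<longleftrightarrow>
    block_pencil Ap Am B (\<i> * l) p = (\<i> *\<^sub>C \<psi>1, (- \<i>) *\<^sub>C \<psi>2)"
proof -
  have cancel: "c *\<^sub>C d *\<^sub>C v = v" if "c * d = 1" for c d and v :: 'a
    using that by (simp add: scaleC_scaleC scaleC_one)
  have rot: "c *\<^sub>C v = w \<longleftrightarrow> v = d *\<^sub>C w" if "c * d = 1" for c d and v w :: 'a
    using that cancel[of c d] cancel[of d c] by (metis mult.commute)
  define q where "q = block_pencil Ap Am B (\<i> * l) p"
  have "shifted_op Ap Am B l p = ((- \<i>) *\<^sub>C fst q, \<i> *\<^sub>C snd q)"
    by (cases p) (simp add: shifted_op_def block_op_def q_def block_pencil_def scaleC_diff_right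
        scaleC_add_right scaleC_minus_left scaleC_minus_right scaleC_scaleC flip: mult.assoc)
  then show ?thesis
    using rot[of "- \<i>" \<i> "fst q" \<psi>1] rot[of \<i> "- \<i>" "snd q" \<psi>2]
    by (simp add: prod_eq_iff flip: q_def)
qed

lemma linear_operator_block_pencil:
  fixes B :: "'a::complex_hilbert_space \<Rightarrow> 'a"
  assumes Ap: "linear_operator D Ap" and Am: "linear_operator D Am" and B: "bounded_clinear B"
  shows "linear_operator (D \<times> D) (block_pencil Ap Am B \<mu>)"
proof -
  have lin: "bounded_linear B" and sc: "\<And>c x. B (c *\<^sub>C x) = c *\<^sub>C B x"
    using B by (auto simp: bounded_clinear_def)
  have "csubspace (D \<times> D)"
    using Ap by (auto simp: linear_operator_def csubspace_def scaleC_prod_def zero_prod_def)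
  then show ?thesis
    using Ap Am
    by (auto simp: linear_operator_def block_pencil_def scaleC_prod_def linear_simps[OF lin] sc
        cadjoint_add[OF B] cadjoint_scaleC[OF B] scaleC_add_right scaleC_diff_right
        scaleC_scaleC mult.commute)
qed

text \<open>
  The weak equation may be tested with vectors supported in one component. It then splits into
  one weak equation for each of \<open>Ap\<close> and \<open>Am\<close>, with the bounded terms moved to the right-hand
  side, and self-adjointness of the diagonal entries gives the claim.
\<close>

lemma block_pencil_graph:
  fixes B :: "'a::complex_hilbert_space \<Rightarrow> 'a"
  assumes Ap: "self_adjoint D Ap" and Am: "self_adjoint D Am" and B: "bounded_clinear B"
  shows "(\<forall>x\<in>D \<times> D. cinner (block_pencil Ap Am B \<mu> x) y = cinner x z)
    \<longleftrightarrow> y \<in> D \<times> D \<and> block_pencil Ap Am B (cnj \<mu>) y = z"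
proof -
  obtain y1 y2 z1 z2 where y: "y = (y1, y2)" and z: "z = (z1, z2)"
    by fastforce
  let ?B' = "cadjoint UNIV B"
  have B': "cinner (?B' v) w = cinner v (B w)" for v w
    by (metis cinner_cadjoint[OF B] cinner_commute)
  have lin: "bounded_linear B"
    using B by (auto simp: bounded_clinear_def)
  have [simp]: "B 0 = 0" "?B' 0 = 0"
    using linear_simps(3)[OF lin] cadjoint_scaleC[OF B, of 0 0] by (auto simp: scaleC_zero_left)
  have lin0: "0 \<in> D" "Ap 0 = 0" "Am 0 = 0"
  proof -
    have "linear_operator D Ap" "linear_operator D Am"
      using Ap Am by (auto simp: self_adjoint_def)
    then show "0 \<in> D" "Ap 0 = 0" "Am 0 = 0"
      unfolding linear_operator_def csubspace_def by (metis scaleC_zero_left)+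
  qed
  define w1 where "w1 = z1 - B y2 + cnj \<mu> *\<^sub>C y1"
  define w2 where "w2 = z2 - ?B' y1 - cnj \<mu> *\<^sub>C y2"
  have split: "cinner (block_pencil Ap Am B \<mu> (x1, x2)) y - cinner (x1, x2) z
      = (cinner (Ap x1) y1 - cinner x1 w1) + (cinner (Am x2) y2 - cinner x2 w2)" for x1 x2
    by (simp add: block_pencil_def cinner_prod_def y z w1_def w2_def cinner_add_left
        cinner_add_right cinner_diff_left cinner_diff_right cinner_scaleC_left
        cinner_scaleC_right B' cinner_cadjoint[OF B])
  have "(\<forall>x\<in>D \<times> D. cinner (block_pencil Ap Am B \<mu> x) y = cinner x z)
      \<longleftrightarrow> (\<forall>x\<in>D. cinner (Ap x) y1 = cinner x w1) \<and> (\<forall>x\<in>D. cinner (Am x) y2 = cinner x w2)"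
    (is "?L \<longleftrightarrow> ?R")
  proof
    assume L: ?L
    have *: "(cinner (Ap x1) y1 - cinner x1 w1) + (cinner (Am x2) y2 - cinner x2 w2) = 0"
      if "x1 \<in> D" "x2 \<in> D" for x1 x2
      using L that split[of x1 x2] by (metis SigmaI eq_iff_diff_eq_0)
    show ?R
      using *[OF _ lin0(1)] *[OF lin0(1)] lin0 by (auto simp: cinner_zero_left)
  next
    assume ?R
    then have "cinner (block_pencil Ap Am B \<mu> (x1, x2)) y - cinner (x1, x2) z = 0"
      if "x1 \<in> D" "x2 \<in> D" for x1 x2
      unfolding split using that by simp
    then show ?L
      by auto
  qed
  also have "\<dots> \<longleftrightarrow> (y1 \<in> D \<and> Ap y1 = w1) \<and> (y2 \<in> D \<and> Am y2 = w2)"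
    by (simp only: self_adjoint_graph[OF Ap] self_adjoint_graph[OF Am])
  also have "\<dots> \<longleftrightarrow> y \<in> D \<times> D \<and> block_pencil Ap Am B (cnj \<mu>) y = z"
    by (auto simp: y z w1_def w2_def block_pencil_def algebra_simps)
  finally show ?thesis .
qed

section \<open>The resolvent estimate\<close>

text \<open>
  The vectors \<open>a\<close>, \<open>d\<close>, \<open>u\<close>, \<open>v\<close> stand for \<open>Ap x\<close>, \<open>Am y\<close>, \<open>B y\<close> and the adjoint of \<open>B\<close> applied
  to \<open>x\<close>. Only these numerical relations matter, and in this form the lemma can be used with the two
  components exchanged. With \<open>p\<close>, \<open>q\<close> the norms of \<open>x\<close>, \<open>y\<close> and \<open>F\<close> the total norm of the data divided
  by \<open>\<bar>Im \<mu>\<bar>\<close>, the bounds \<open>p \<le> F + q / 2\<close> and \<open>q \<le> p + F\<close> give \<open>q \<le> 4 * F\<close> and \<open>p \<le> 3 * F\<close>, hence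
  the constant \<open>7\<close>.
\<close>

lemma coupled_estimate:
  fixes x y :: "'a::complex_inner"
  assumes a: "Im (cinner a x) = 0" and d: "Im (cinner d y) = 0"
    and uv: "cinner u x = cnj (cinner v y)"
    and u: "norm u \<le> b * norm y"
    and m: "m * (norm x)\<^sup>2 \<le> \<bar>Re (cinner a x) - Re \<mu> * (norm x)\<^sup>2\<bar>" "2 * b \<le> m" "0 < m"
    and \<mu>: "Im \<mu> \<noteq> 0"
  shows "norm x + norm y \<le>
    7 * inverse \<bar>Im \<mu>\<bar> * (norm (a + u - \<mu> *\<^sub>C x) + norm (v + d + \<mu> *\<^sub>C y))"
proof -
  define f where "f = a + u - \<mu> *\<^sub>C x"
  define g where "g = v + d + \<mu> *\<^sub>C y"
  define p where "p = norm x"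
  define q where "q = norm y"
  define r where "r = \<bar>Im \<mu>\<bar>"
  define F where "F = (norm f + norm g) / r"
  have r: "r > 0"
    using \<mu> by (simp add: r_def)
  have pq: "0 \<le> p" "0 \<le> q"
    by (auto simp: p_def q_def)
  have fx: "cinner f x = cinner a x + cinner u x - \<mu> * complex_of_real (p\<^sup>2)"
    by (simp only: f_def cinner_diff_left cinner_add_left cinner_scaleC_left cinner_self p_def)
  have gy: "cinner g y = cinner v y + cinner d y + \<mu> * complex_of_real (q\<^sup>2)"
    by (simp only: g_def cinner_add_left cinner_scaleC_left cinner_self q_def)
  have ux: "cmod (cinner f x - cinner u x) \<le> (norm f + b * q) * p"
  proof -
    have "cmod (cinner f x - cinner u x) \<le> norm f * p + norm u * p"
      using norm_triangle_ineq4[of "cinner f x" "cinner u x"] norm_cinner_le[of f x]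
        norm_cinner_le[of u x] unfolding p_def by linarith
    also have "\<dots> \<le> norm f * p + b * q * p"
      using u by (intro add_left_mono mult_right_mono) (auto simp: p_def q_def)
    finally show ?thesis
      by (simp add: algebra_simps)
  qed
  have cancel: "k * p \<le> norm f + b * q" if "k * p\<^sup>2 \<le> cmod (cinner f x - cinner u x)" "0 < k" for k
  proof (cases "p = 0")
    case False
    have "(k * p) * p \<le> (norm f + b * q) * p"
      using that ux by (simp add: power2_eq_square mult.assoc)
    then show ?thesis
      using False pq by (auto simp: mult_le_cancel_right)
  next
    case True
    have "0 \<le> b * q"
      using u norm_ge_zero[of u] unfolding q_def by linarith
    with True show ?thesis
      by simp
  qed
  \<comment> \<open>Real and imaginary part of the first row, tested with \<open>x\<close>.\<close>
  have mp: "m * p \<le> norm f + b * q"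
  proof (rule cancel)
    show "m * p\<^sup>2 \<le> cmod (cinner f x - cinner u x)"
      using m(1) abs_Re_le_cmod[of "cinner f x - cinner u x"] by (simp add: fx p_def)
  qed (rule m(3))
  have rp: "r * p \<le> norm f + b * q"
  proof (rule cancel)
    show "r * p\<^sup>2 \<le> cmod (cinner f x - cinner u x)"
      using abs_Im_le_cmod[of "cinner f x - cinner u x"] a by (simp add: fx r_def abs_mult)
  qed (rule r)
  have p_le: "p \<le> norm f / r + q / 2"
  proof -
    \<comment> \<open>A factor \<open>m\<close> makes the coupling term at most \<open>q / 2\<close>, and a factor \<open>r\<close> gives the decay in
      \<open>Im \<mu>\<close>; the larger of the two does both.\<close>
    define M where "M = max m r"
    have M: "0 < M" "2 * b \<le> M" "r \<le> M"
      using m r by (auto simp: M_def)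
    have "M * p \<le> norm f + b * q"
      using mp rp by (auto simp: M_def max_def)
    also have "\<dots> \<le> norm f + M * (q / 2)"
      using mult_right_mono[OF M(2) pq(2)] by simp
    finally have "p \<le> norm f / M + q / 2"
      using M(1) by (simp add: field_simps)
    also have "norm f / M \<le> norm f / r"
      using M r by (intro divide_left_mono) auto
    finally show ?thesis
      by simp
  qed
  then have p_le: "p \<le> F + q / 2"
    using r by (simp add: F_def add_divide_distrib) (smt (verit) divide_nonneg_pos norm_ge_zero)
  \<comment> \<open>The coupling terms are complex conjugates of each other, so their sum is real.\<close>
  have "Im (cinner f x + cinner g y) = Im \<mu> * (q\<^sup>2 - p\<^sup>2)"
    using a d uv by (simp add: fx gy algebra_simps)
  then have "r * \<bar>q\<^sup>2 - p\<^sup>2\<bar> \<le> cmod (cinner f x + cinner g y)"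
    using abs_Im_le_cmod[of "cinner f x + cinner g y"] by (simp add: r_def abs_mult)
  also have "\<dots> \<le> norm f * p + norm g * q"
    using norm_triangle_ineq[of "cinner f x" "cinner g y"] norm_cinner_le[of f x]
      norm_cinner_le[of g y] unfolding p_def q_def by linarith
  also have "\<dots> \<le> (norm f + norm g) * (p + q)"
    using pq by (simp add: algebra_simps)
  finally have "\<bar>q\<^sup>2 - p\<^sup>2\<bar> \<le> F * (p + q)"
    using r by (simp add: F_def field_simps)
  then have "(q - p) * (p + q) \<le> F * (p + q)"
    by (simp add: power2_eq_square algebra_simps)
  moreover have "0 \<le> F"
    using r by (simp add: F_def)
  ultimately have "q \<le> p + F"
    using pq by (cases "p + q = 0") (auto simp: mult_le_cancel_right)
  with p_le have "p + q \<le> 7 * F"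
    by linarith
  then show ?thesis
    by (simp add: F_def p_def q_def r_def f_def g_def field_simps)
qed

text \<open>
  What remains is to see which component is coercive: for operators bounded from below it is the
  first one if \<open>Re \<mu>\<close> is negative and the second one if it is positive, and conversely for operators
  bounded from above.
\<close>

lemma block_pencil_estimate:
  fixes B :: "'a::complex_hilbert_space \<Rightarrow> 'a"
  assumes Ap: "self_adjoint D Ap" and Am: "self_adjoint D Am" and B: "bounded_clinear B"
    and semibounded: "bounded_from_below D Ap \<gamma> \<and> bounded_from_below D Am \<gamma> \<or>
      bounded_from_above D Ap \<gamma> \<and> bounded_from_above D Am \<gamma>"
    and \<mu>: "\<bar>\<gamma>\<bar> + 2 * \<bar>onorm B\<bar> + 1 \<le> \<bar>Re \<mu>\<bar>" "Im \<mu> \<noteq> 0"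
    and xy: "x \<in> D" "y \<in> D"
    and fg: "block_pencil Ap Am B \<mu> (x, y) = (f, g)"
  shows "norm x + norm y \<le> 7 * inverse \<bar>Im \<mu>\<bar> * (norm f + norm g)"
proof -
  let ?B' = "cadjoint UNIV B"
  define m where "m = 2 * \<bar>onorm B\<bar> + 1"
  have lin: "bounded_linear B"
    using B by (simp add: bounded_clinear_def)
  have f: "f = Ap x + B y - \<mu> *\<^sub>C x" and g: "g = ?B' x + Am y + \<mu> *\<^sub>C y"
    using fg by (auto simp: block_pencil_def)
  have Im0: "Im (cinner (Ap x) x) = 0" "Im (cinner (Am y) y) = 0"
    using self_adjoint_Im_eq_0 Ap Am xy by blast+
  have dual: "cinner (B y) x = cnj (cinner (?B' x) y)"
    by (metis cinner_cadjoint[OF B] cinner_commute)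
  have m: "2 * onorm B \<le> m" "0 < m"
    by (auto simp: m_def)
  \<comment> \<open>To be used with \<open>t\<close> the value of a quadratic form, \<open>s\<close> the squared norm and \<open>k\<close> the real part of
    the shift, which lies beyond the bound \<open>\<gamma>\<close> of the form, at distance at least \<open>m\<close> from it.\<close>
  have far: "m * s \<le> \<bar>t - k * s\<bar>"
    if "0 \<le> s" "m \<le> k - \<gamma> \<and> t \<le> \<gamma> * s \<or> m \<le> \<gamma> - k \<and> \<gamma> * s \<le> t" for s t k :: real
    using that(2)
  proof
    assume "m \<le> k - \<gamma> \<and> t \<le> \<gamma> * s"
    then have "m * s \<le> (k - \<gamma>) * s" "t \<le> \<gamma> * s"
      using that(1) by (auto intro: mult_right_mono)
    then show ?thesis
      by (simp add: algebra_simps)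
  next
    assume "m \<le> \<gamma> - k \<and> \<gamma> * s \<le> t"
    then have "m * s \<le> (\<gamma> - k) * s" "\<gamma> * s \<le> t"
      using that(1) by (auto intro: mult_right_mono)
    then show ?thesis
      by (simp add: algebra_simps)
  qed
  have "Re \<mu> \<le> - (\<bar>\<gamma>\<bar> + m) \<or> \<bar>\<gamma>\<bar> + m \<le> Re \<mu>"
    using \<mu>(1) by (auto simp: m_def)
  then have "m * (norm x)\<^sup>2 \<le> \<bar>Re (cinner (Ap x) x) - Re \<mu> * (norm x)\<^sup>2\<bar> \<or>
      m * (norm y)\<^sup>2 \<le> \<bar>Re (cinner (Am y) y) - Re (- \<mu>) * (norm y)\<^sup>2\<bar>"
    using semibounded xy far[of "(norm x)\<^sup>2" "Re \<mu>" "Re (cinner (Ap x) x)"]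
      far[of "(norm y)\<^sup>2" "Re (- \<mu>)" "Re (cinner (Am y) y)"]
    unfolding bounded_from_below_def bounded_from_above_def
    by (smt (verit) uminus_complex.sel(1) zero_le_power2)
  then show ?thesis
  proof
    assume "m * (norm x)\<^sup>2 \<le> \<bar>Re (cinner (Ap x) x) - Re \<mu> * (norm x)\<^sup>2\<bar>"
    from coupled_estimate[OF Im0 dual onorm[OF lin] this m \<mu>(2)] show ?thesis
      by (simp add: f g)
  next
    \<comment> \<open>Exchanging the two components replaces \<open>\<mu>\<close> by \<open>- \<mu>\<close> and \<open>B\<close> by its adjoint.\<close>
    assume coercive: "m * (norm y)\<^sup>2 \<le> \<bar>Re (cinner (Am y) y) - Re (- \<mu>) * (norm y)\<^sup>2\<bar>"
    have "cinner (?B' x) y = cnj (cinner (B y) x)"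
      using dual by simp
    from coupled_estimate[OF Im0(2,1) this norm_cadjoint_le[OF B] coercive m] \<mu>(2)
    show ?thesis
      by (simp add: f g scaleC_minus_left algebra_simps)
  qed
qed

lemma block_pencil_bijective:
  fixes B :: "'a::complex_hilbert_space \<Rightarrow> 'a"
  assumes Ap: "self_adjoint D Ap" and Am: "self_adjoint D Am" and B: "bounded_clinear B"
    and semibounded: "bounded_from_below D Ap \<gamma> \<and> bounded_from_below D Am \<gamma> \<or>
      bounded_from_above D Ap \<gamma> \<and> bounded_from_above D Am \<gamma>"
    and \<mu>: "\<bar>\<gamma>\<bar> + 2 * \<bar>onorm B\<bar> + 1 \<le> \<bar>Re \<mu>\<bar>" "Im \<mu> \<noteq> 0"
  shows "\<exists>!p. p \<in> D \<times> D \<and> block_pencil Ap Am B \<mu> p = q"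
proof -
  let ?L = "block_pencil Ap Am B"
  have lin: "linear_operator (D \<times> D) (?L \<nu>)" for \<nu>
    using Ap Am B by (intro linear_operator_block_pencil) (auto simp: self_adjoint_def)
  have lower: "norm p \<le> 14 * inverse \<bar>Im \<nu>\<bar> * norm (?L \<nu> p)"
    if "p \<in> D \<times> D" "\<nu> = \<mu> \<or> \<nu> = cnj \<mu>" for p \<nu>
  proof -
    obtain x y f g where p: "p = (x, y)" and fg: "?L \<nu> (x, y) = (f, g)"
      by fastforce
    have "norm p \<le> norm x + norm y"
      unfolding p by (rule norm_Pair_le)
    also have "\<dots> \<le> 7 * inverse \<bar>Im \<nu>\<bar> * (norm f + norm g)"
      using that \<mu> p by (intro block_pencil_estimate[OF Ap Am B semibounded _ _ _ _ fg]) auto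
    also have "\<dots> \<le> 7 * inverse \<bar>Im \<nu>\<bar> * (2 * norm (f, g))"
      using norm_fst_le[of f g] norm_snd_le[of g f]
      by (intro mult_left_mono) auto
    finally show ?thesis
      by (simp add: p fg)
  qed
  have "\<exists>p\<in>D \<times> D. ?L \<mu> p = q"
  proof (rule surjective_of_bounded_below[OF lin])
    show "(\<forall>x\<in>D \<times> D. cinner (?L (cnj \<mu>) x) y = cinner x z) \<longleftrightarrow> y \<in> D \<times> D \<and> ?L \<mu> y = z" for y z
      using block_pencil_graph[OF Ap Am B, of "cnj \<mu>" y z] by simp
    show "norm x \<le> 14 * inverse \<bar>Im \<mu>\<bar> * norm (?L \<mu> x)" if "x \<in> D \<times> D" for x
      using lower that by blast
    show "y = 0" if "\<And>x. x \<in> D \<times> D \<Longrightarrow> cinner (?L \<mu> x) y = 0" for y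
    proof -
      have "y \<in> D \<times> D \<and> ?L (cnj \<mu>) y = 0"
        using block_pencil_graph[OF Ap Am B, of \<mu> y 0] that by (simp add: cinner_zero_right)
      then show ?thesis
        using lower[of y "cnj \<mu>"] by simp
    qed
  qed
  moreover have "p = p'" if "p \<in> D \<times> D" "p' \<in> D \<times> D" "?L \<mu> p = ?L \<mu> p'" for p p'
  proof -
    have D: "csubspace (D \<times> D)" and add: "\<And>p q. p \<in> D \<times> D \<Longrightarrow> q \<in> D \<times> D \<Longrightarrow>
        ?L \<mu> (p + q) = ?L \<mu> p + ?L \<mu> q"
      using lin[of \<mu>] by (auto simp: linear_operator_def)
    have d: "p - p' \<in> D \<times> D"
      using csubspace_diff[OF D] that by blast
    from add[OF d that(2)] have "?L \<mu> (p - p') = 0"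
      using that(3) by simp
    then show ?thesis
      using lower[OF d, of \<mu>] by simp
  qed
  ultimately show ?thesis
    by blast
qed

theorem theorem4:
  shows "\<exists>\<rho> :: real \<Rightarrow> real \<Rightarrow> real. (\<forall>\<gamma> b. \<rho> \<gamma> b > 0) \<and>
    (\<forall>\<gamma> (D :: 'h::complex_hilbert_space set) (Ap :: 'h \<Rightarrow> 'h) (Am :: 'h \<Rightarrow> 'h) (B :: 'h \<Rightarrow> 'h).
      closed_operator D Ap \<and> self_adjoint D Ap \<and>
      closed_operator D Am \<and> self_adjoint D Am \<and>
      (bounded_from_below D Ap \<gamma> \<and> bounded_from_below D Am \<gamma> \<or>
       bounded_from_above D Ap \<gamma> \<and> bounded_from_above D Am \<gamma>) \<and>
      bounded_clinear B \<longrightarrow>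
      (\<exists>C>0. \<forall>l::complex. \<bar>Im l\<bar> \<ge> \<rho> \<gamma> (onorm B) \<and> Re l \<noteq> 0 \<longrightarrow>
        (\<forall>\<psi>1 \<psi>2.
          (\<exists>!\<phi>. \<phi> \<in> D \<times> D \<and> shifted_op Ap Am B l \<phi> = (\<psi>1, \<psi>2)) \<and>
          (\<forall>\<phi>1\<in>D. \<forall>\<phi>2\<in>D. shifted_op Ap Am B l (\<phi>1, \<phi>2) = (\<psi>1, \<psi>2) \<longrightarrow>
            norm \<phi>1 + norm \<phi>2 \<le> C * inverse \<bar>Re l\<bar> * (norm \<psi>1 + norm \<psi>2)))))"
proof (intro exI[of _ "\<lambda>\<gamma> b. \<bar>\<gamma>\<bar> + 2 * \<bar>b\<bar> + 1"] conjI allI impI)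
  fix \<gamma> and D :: "'h set" and Ap Am B :: "'h \<Rightarrow> 'h"
  assume *: "closed_operator D Ap \<and> self_adjoint D Ap \<and>
      closed_operator D Am \<and> self_adjoint D Am \<and>
      (bounded_from_below D Ap \<gamma> \<and> bounded_from_below D Am \<gamma> \<or>
       bounded_from_above D Ap \<gamma> \<and> bounded_from_above D Am \<gamma>) \<and>
      bounded_clinear B"
  then have Ap: "self_adjoint D Ap" and Am: "self_adjoint D Am" and B: "bounded_clinear B"
    and semibounded: "bounded_from_below D Ap \<gamma> \<and> bounded_from_below D Am \<gamma> \<or>
       bounded_from_above D Ap \<gamma> \<and> bounded_from_above D Am \<gamma>"
    by simp_all
  show "\<exists>C>0. \<forall>l::complex. \<bar>Im l\<bar> \<ge> \<bar>\<gamma>\<bar> + 2 * \<bar>onorm B\<bar> + 1 \<and> Re l \<noteq> 0 \<longrightarrow>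
        (\<forall>\<psi>1 \<psi>2.
          (\<exists>!\<phi>. \<phi> \<in> D \<times> D \<and> shifted_op Ap Am B l \<phi> = (\<psi>1, \<psi>2)) \<and>
          (\<forall>\<phi>1\<in>D. \<forall>\<phi>2\<in>D. shifted_op Ap Am B l (\<phi>1, \<phi>2) = (\<psi>1, \<psi>2) \<longrightarrow>
            norm \<phi>1 + norm \<phi>2 \<le> C * inverse \<bar>Re l\<bar> * (norm \<psi>1 + norm \<psi>2)))"
  proof (intro exI[of _ 7] conjI allI impI ballI)
    fix l :: complex and \<psi>1 \<psi>2 :: 'h
    assume "\<bar>\<gamma>\<bar> + 2 * \<bar>onorm B\<bar> + 1 \<le> \<bar>Im l\<bar> \<and> Re l \<noteq> 0"
    then have \<mu>: "\<bar>\<gamma>\<bar> + 2 * \<bar>onorm B\<bar> + 1 \<le> \<bar>Re (\<i> * l)\<bar>" "Im (\<i> * l) \<noteq> 0"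
      by simp_all
    show "\<exists>!\<phi>. \<phi> \<in> D \<times> D \<and> shifted_op Ap Am B l \<phi> = (\<psi>1, \<psi>2)"
      unfolding shifted_op_eq_iff_block_pencil
      by (rule block_pencil_bijective[OF Ap Am B semibounded \<mu>])
    fix \<phi>1 \<phi>2
    assume \<phi>: "\<phi>1 \<in> D" "\<phi>2 \<in> D" and "shifted_op Ap Am B l (\<phi>1, \<phi>2) = (\<psi>1, \<psi>2)"
    then have "block_pencil Ap Am B (\<i> * l) (\<phi>1, \<phi>2) = (\<i> *\<^sub>C \<psi>1, (- \<i>) *\<^sub>C \<psi>2)"
      by (simp only: shifted_op_eq_iff_block_pencil)
    from block_pencil_estimate[OF Ap Am B semibounded \<mu> \<phi> this]
    show "norm \<phi>1 + norm \<phi>2 \<le> 7 * inverse \<bar>Re l\<bar> * (norm \<psi>1 + norm \<psi>2)"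
      by (simp add: norm_scaleC)
  qed simp
qed simp

end
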